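(* Let $G$ be a graph, $H$ a subgraph of $G$ such that $E(H)$ is a clique in $L(G)^2$, and $a\in\left[\frac14,\frac13\right]$. Suppose that for every bipartite subgraph $H'$ of $H$ with $|E(H')|<|E(H)|$ we have $|E(H')|\leq a\cdot \sigma_{G[V(H')]}(H')^2$. Then $|E(H)|\leq \frac{1+a}{4}\,\sigma_G(H)^2$.
   Context: For a graph $G$, $L(G)^2$ denotes the square of the line graph of $G$: its vertices are the edges of $G$, and two distinct edges $e,f$ of $G$ are adjacent in $L(G)^2$ if and only if they share an end, or some edge of $G$ joins an end of $e$ to an end of $f$. A set of edges is a clique in $L(G)^2$ if its elements are pairwise adjacent there. For a subgraph $H$ of a graph $G$, the Ore-degree of $H$ in $G$ is $\sigma_G(H)=\max_{xy\in E(H)}(d_G(x)+d_G(y))$ (taken to be $0$ if $H$ has no edges). $G[V(H')]$ is the subgraph of $G$ induced by $V(H')$. *)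

theory Defs
  imports Complex_Main
begin

record 'v ugraph =
  gverts :: "'v set"
  gedges :: "'v set set"

definition is_graph :: "'v ugraph \<Rightarrow> bool" where
  "is_graph G \<longleftrightarrow>
     finite (gverts G) \<and> (\<forall>e \<in> gedges G. e \<subseteq> gverts G \<and> card e = 2)"

definition is_subgraph :: "'v ugraph \<Rightarrow> 'v ugraph \<Rightarrow> bool" where
  "is_subgraph H G \<longleftrightarrow>
     is_graph H \<and> gverts H \<subseteq> gverts G \<and> gedges H \<subseteq> gedges G"

definition induced_on :: "'v ugraph \<Rightarrow> 'v set \<Rightarrow> 'v ugraph" where
  "induced_on G S = \<lparr> gverts = S, gedges = {e \<in> gedges G. e \<subseteq> S} \<rparr>"

definition gdegree :: "'v ugraph \<Rightarrow> 'v \<Rightarrow> nat" where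
  "gdegree G v = card {e \<in> gedges G. v \<in> e}"

definition is_bipartite :: "'v ugraph \<Rightarrow> bool" where
  "is_bipartite G \<longleftrightarrow>
     (\<exists>A B. A \<union> B = gverts G \<and> A \<inter> B = {} \<and>
        (\<forall>e \<in> gedges G. \<exists>x \<in> A. \<exists>y \<in> B. e = {x, y}))"

definition line_graph_square :: "'v ugraph \<Rightarrow> 'v set ugraph" where
  "line_graph_square G =
     \<lparr> gverts = gedges G,
       gedges = {{e, f} | e f. e \<in> gedges G \<and> f \<in> gedges G \<and> e \<noteq> f \<and>
                  (e \<inter> f \<noteq> {} \<or> (\<exists>x \<in> e. \<exists>y \<in> f. {x, y} \<in> gedges G))} \<rparr>"

definition is_clique :: "'v ugraph \<Rightarrow> 'v set \<Rightarrow> bool" where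
  "is_clique G C \<longleftrightarrow>
     C \<subseteq> gverts G \<and> (\<forall>x \<in> C. \<forall>y \<in> C. x \<noteq> y \<longrightarrow> {x, y} \<in> gedges G)"

definition ore_degree :: "'v ugraph \<Rightarrow> 'v ugraph \<Rightarrow> nat" where
  "ore_degree G H =
     (if gedges H = {} then 0
      else Max {gdegree G x + gdegree G y | x y. {x, y} \<in> gedges H})"

end

theory Submission imports Defs begin

text \<open>
  Write \<open>\<sigma>\<close> for the Ore-degree of \<open>H\<close>, \<open>d\<close> for degrees in \<open>H\<close>, \<open>N\<close> for
  neighbourhoods in \<open>G\<close>, and \<open>S(v)\<close> for the sum of \<open>d\<close> over \<open>N(v)\<close>. If \<open>uv\<close> is an edge of \<open>H\<close>,
  every edge of \<open>H\<close> meets \<open>N(u) \<union> N(v)\<close>. The edges that avoid \<open>N(v)\<close> and do not lie inside \<open>N(u)\<close>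
  form a bipartite graph \<open>B\<close>. For each \<open>H\<close>-neighbour \<open>w\<close> of \<open>v\<close>, an edge of \<open>B\<close> has an end adjacent
  to \<open>w\<close>, and \<open>w\<close> is not a vertex of \<open>B\<close>; so \<open>B\<close> has Ore-degree at most \<open>\<sigma> - d(v)\<close> and at
  most \<open>a (\<sigma> - d(v))\<^sup>2\<close> edges. The edges inside \<open>N(u)\<close> are counted twice by \<open>S(u)\<close>. Hence adding
  the bounds for \<open>(u, v)\<close> and \<open>(v, u)\<close> gives
  \<open>2 |E(H)| \<le> S(u) + S(v) + a ((\<sigma> - d(u))\<^sup>2 + (\<sigma> - d(v))\<^sup>2)\<close>, and also \<open>|E(H)| \<le> S(u) + S(v)\<close>.
  Now take \<open>u\<close> of maximum degree \<open>D\<close> in \<open>H\<close> and \<open>v\<close> of maximum degree \<open>D'\<close> among its \<open>H\<close>-neighbours: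
  then \<open>S(u) + S(v) \<le> D (\<sigma> - D + D')\<close>, and the rest is an inequality in \<open>D\<close>, \<open>D'\<close> and \<open>\<sigma>\<close>.
\<close>

section \<open>Neighbourhoods and degree sums\<close>

definition nbhd :: "'v ugraph \<Rightarrow> 'v \<Rightarrow> 'v set" where
  "nbhd G v = {w. {v, w} \<in> gedges G}"

definition edges_meeting :: "'v ugraph \<Rightarrow> 'v set \<Rightarrow> 'v set set" where
  "edges_meeting G A = {e \<in> gedges G. e \<inter> A \<noteq> {}}"

definition edges_inside :: "'v ugraph \<Rightarrow> 'v set \<Rightarrow> 'v set set" where
  "edges_inside G A = {e \<in> gedges G. e \<subseteq> A}"

definition nbhd_degree_sum :: "'v ugraph \<Rightarrow> 'v ugraph \<Rightarrow> 'v \<Rightarrow> nat" where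
  "nbhd_degree_sum G H v = (\<Sum>w\<in>nbhd G v. gdegree H w)"

lemma nbhd_sym: "w \<in> nbhd G v \<longleftrightarrow> v \<in> nbhd G w"
  by (simp add: nbhd_def insert_commute)

lemma graph_edgeE:
  assumes "is_graph G" "e \<in> gedges G"
  obtains x y where "e = {x, y}" "x \<noteq> y" "x \<in> gverts G" "y \<in> gverts G"
proof -
  have "card e = 2" "e \<subseteq> gverts G" using assms by (simp_all add: is_graph_def)
  then show thesis using that by (metis card_2_iff insert_subset)
qed

lemma finite_gedges: "is_graph G \<Longrightarrow> finite (gedges G)"
  unfolding is_graph_def by (rule finite_subset[of _ "Pow (gverts G)"]) auto

lemma nbhd_subset: "is_graph G \<Longrightarrow> nbhd G v \<subseteq> gverts G"
  by (auto simp: is_graph_def nbhd_def)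

lemma finite_nbhd: "is_graph G \<Longrightarrow> finite (nbhd G v)"
  by (rule finite_subset[OF nbhd_subset]) (simp_all add: is_graph_def)

lemma card_nbhd:
  assumes "is_graph G"
  shows "card (nbhd G v) = gdegree G v"
proof -
  have "(\<lambda>w. {v, w}) ` nbhd G v = {e \<in> gedges G. v \<in> e}"
  proof (intro equalityI subsetI)
    fix e assume "e \<in> {e \<in> gedges G. v \<in> e}"
    then have e: "e \<in> gedges G" "v \<in> e" by auto
    obtain x y where "e = {x, y}" using graph_edgeE[OF assms e(1)] .
    then have "e = {v, x} \<or> e = {v, y}" using e(2) by auto
    with e(1) show "e \<in> (\<lambda>w. {v, w}) ` nbhd G v" by (auto simp: nbhd_def)
  qed (auto simp: nbhd_def)
  moreover have "inj_on (\<lambda>w. {v, w}) (nbhd G v)"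
    by (auto simp: inj_on_def doubleton_eq_iff)
  ultimately show ?thesis
    unfolding gdegree_def by (metis card_image)
qed

lemma gdegree_mono:
  assumes "is_graph G" "is_subgraph H G"
  shows "gdegree H v \<le> gdegree G v"
  unfolding gdegree_def using assms finite_gedges[OF assms(1)]
  by (intro card_mono) (auto simp: is_subgraph_def)

text \<open>Double counting of incidences: an edge contributes once if it meets \<open>A\<close>,
  and once more if its second end is in \<open>A\<close> too.\<close>

lemma sum_gdegree:
  assumes "is_graph H" "finite A"
  shows "(\<Sum>w\<in>A. gdegree H w) = card (edges_meeting H A) + card (edges_inside H A)"
proof -
  have fin: "finite (gedges H)" using assms finite_gedges by blast
  have "(\<Sum>w\<in>A. gdegree H w) = (\<Sum>w\<in>A. \<Sum>e\<in>gedges H. of_bool (w \<in> e))"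
    unfolding gdegree_def using fin by (simp add: Int_def)
  also have "\<dots> = (\<Sum>e\<in>gedges H. \<Sum>w\<in>A. of_bool (w \<in> e))"
    by (rule sum.swap)
  also have "\<dots> = (\<Sum>e\<in>gedges H. of_bool (e \<inter> A \<noteq> {}) + of_bool (e \<subseteq> A))"
  proof (rule sum.cong[OF refl])
    fix e assume "e \<in> gedges H"
    then obtain x y where e: "e = {x, y}" "x \<noteq> y" using graph_edgeE[OF assms(1)] by metis
    have "(\<Sum>w\<in>A. of_bool (w \<in> e)) = card (A \<inter> e)"
      using assms(2) by (simp add: Int_def)
    also have "A \<inter> e = (if x \<in> A then {x} else {}) \<union> (if y \<in> A then {y} else {})"
      using e by auto
    also have "card \<dots> = of_bool (e \<inter> A \<noteq> {}) + of_bool (e \<subseteq> A)"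
      using e by auto
    finally show "(\<Sum>w\<in>A. of_bool (w \<in> e)) = (of_bool (e \<inter> A \<noteq> {}) + of_bool (e \<subseteq> A) :: nat)" .
  qed
  also have "\<dots> = card (edges_meeting H A) + card (edges_inside H A)"
    unfolding edges_meeting_def edges_inside_def using fin
    by (simp add: sum.distrib Int_def)
  finally show ?thesis .
qed

section \<open>Bounds on the Ore-degree\<close>

lemma finite_ore_set:
  assumes "is_graph H"
  shows "finite {gdegree G x + gdegree G y | x y. {x, y} \<in> gedges H}"
proof (rule finite_subset)
  show "{gdegree G x + gdegree G y | x y. {x, y} \<in> gedges H}
    \<subseteq> (\<lambda>(x, y). gdegree G x + gdegree G y) ` (gverts H \<times> gverts H)"
    using assms unfolding is_graph_def by force
  show "finite ((\<lambda>(x, y). gdegree G x + gdegree G y) ` (gverts H \<times> gverts H))"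
    using assms unfolding is_graph_def by blast
qed

lemma ore_degree_ge:
  assumes "is_graph H" "{x, y} \<in> gedges H"
  shows "gdegree G x + gdegree G y \<le> ore_degree G H"
  unfolding ore_degree_def using assms(2) Max_ge[OF finite_ore_set[OF assms(1)]] by auto

lemma ore_degree_le:
  assumes "is_graph H"
    and "\<And>x y. {x, y} \<in> gedges H \<Longrightarrow> gdegree G x + gdegree G y \<le> k"
  shows "ore_degree G H \<le> k"
proof (cases "gedges H = {}")
  case False
  then obtain x y where "{x, y} \<in> gedges H" using assms(1) graph_edgeE by (metis ex_in_conv)
  then have "{gdegree G x + gdegree G y | x y. {x, y} \<in> gedges H} \<noteq> {}" by blast
  then have "Max {gdegree G x + gdegree G y | x y. {x, y} \<in> gedges H} \<le> k"
    using assms by (subst Max_le_iff[OF finite_ore_set[OF assms(1)]]) auto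
  then show ?thesis using False by (simp add: ore_degree_def)
qed (simp add: ore_degree_def)

section \<open>Cliques in the square of the line graph\<close>

lemma line_square_cliqueD:
  assumes "is_clique (line_graph_square G) C" "e \<in> C" "f \<in> C" "e \<noteq> f"
  shows "e \<inter> f \<noteq> {} \<or> (\<exists>x\<in>e. \<exists>y\<in>f. {x, y} \<in> gedges G)"
proof -
  have "{e, f} \<in> gedges (line_graph_square G)"
    using assms by (auto simp: is_clique_def)
  then obtain e' f' where "{e, f} = {e', f'}"
    and *: "e' \<inter> f' \<noteq> {} \<or> (\<exists>x\<in>e'. \<exists>y\<in>f'. {x, y} \<in> gedges G)"
    unfolding line_graph_square_def ugraph.simps mem_Collect_eq by metis
  then consider "e = e'" "f = f'" | "e = f'" "f = e'"
    by (auto simp: doubleton_eq_iff)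
  then show ?thesis
  proof cases
    case 2
    then show ?thesis using * by (metis insert_commute inf_commute)
  qed (use * in simp)
qed

text \<open>Since \<open>u\<close> and \<open>v\<close> are adjacent, each lies in the neighbourhood
  of the other, so an edge sharing an end with \<open>{u, v}\<close> qualifies as well as one joined
  to it.\<close>

lemma clique_edge_meets_nbhds:
  assumes "is_subgraph H G" "is_clique (line_graph_square G) (gedges H)"
    and "{u, v} \<in> gedges H" "f \<in> gedges H"
  shows "f \<inter> (nbhd G u \<union> nbhd G v) \<noteq> {}"
proof -
  have "{u, v} \<in> gedges G" using assms by (auto simp: is_subgraph_def)
  then have uv: "u \<in> nbhd G v" "v \<in> nbhd G u" by (auto simp: nbhd_def insert_commute)
  show ?thesis
  proof (cases "{u, v} \<inter> f = {}")
    case True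
    then have "{u, v} \<noteq> f" by blast
    then obtain x y where "x \<in> {u, v}" "y \<in> f" "{x, y} \<in> gedges G"
      using line_square_cliqueD[OF assms(2-4)] True by blast
    then show ?thesis by (auto simp: nbhd_def)
  qed (use uv in auto)
qed

text \<open>The edges meeting one of the two neighbourhoods exhaust \<open>H\<close>; each degree
  sum dominates the number of edges meeting its neighbourhood.\<close>

lemma clique_card_le_degree_sums:
  assumes "is_graph G" "is_subgraph H G" "is_clique (line_graph_square G) (gedges H)"
    and "{u, v} \<in> gedges H"
  shows "card (gedges H) \<le> nbhd_degree_sum G H u + nbhd_degree_sum G H v"
proof -
  have H: "is_graph H" using assms by (simp add: is_subgraph_def)
  have "gedges H \<subseteq> edges_meeting H (nbhd G u) \<union> edges_meeting H (nbhd G v)"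
    using clique_edge_meets_nbhds[OF assms(2-4)] by (auto simp: edges_meeting_def)
  then have "card (gedges H) \<le> card (edges_meeting H (nbhd G u) \<union> edges_meeting H (nbhd G v))"
    using finite_gedges[OF H] by (intro card_mono) (auto simp: edges_meeting_def)
  also have "\<dots> \<le> card (edges_meeting H (nbhd G u)) + card (edges_meeting H (nbhd G v))"
    by (rule card_Un_le)
  finally show ?thesis
    using sum_gdegree[OF H finite_nbhd[OF assms(1)]] by (simp add: nbhd_degree_sum_def)
qed

section \<open>The bipartite graph of edges avoiding a neighbourhood\<close>

lemma card_avoiding_edges_le:
  fixes G H :: "'v ugraph" and a :: real
  assumes G: "is_graph G" and HG: "is_subgraph H G"
    and clique: "is_clique (line_graph_square G) (gedges H)"
    and "0 \<le> a"
    and bip: "\<And>H' :: 'v ugraph. is_subgraph H' H \<Longrightarrow> is_bipartite H' \<Longrightarrow>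
           card (gedges H') < card (gedges H) \<Longrightarrow>
           real (card (gedges H'))
             \<le> a * (real (ore_degree (induced_on G (gverts H')) H'))\<^sup>2"
    and uv: "{u, v} \<in> gedges H"
    and B_def: "B = gedges H - edges_meeting H (nbhd G v) - edges_inside H (nbhd G u)"
  shows "real (card B) \<le> a * (real (ore_degree G H) - real (gdegree H v))\<^sup>2"
proof -
  have H: "is_graph H" using HG by (simp add: is_subgraph_def)
  have sub: "gedges H \<subseteq> gedges G" using HG by (simp add: is_subgraph_def)
  define W where "W = \<Union> B"
  define H' :: "'v ugraph" where "H' = \<lparr>gverts = W, gedges = B\<rparr>"
  define G' where "G' = induced_on G W"
  have BH: "B \<subseteq> gedges H" by (auto simp: B_def)
  have avoid: "W \<inter> nbhd G v = {}" by (auto simp: W_def B_def edges_meeting_def)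
  have WH: "W \<subseteq> gverts H" using H BH by (auto simp: W_def is_graph_def)
  then have "finite W" using H finite_subset by (auto simp: is_graph_def)
  then have H': "is_graph H'"
    using H BH unfolding is_graph_def H'_def W_def by auto
  then have H'H: "is_subgraph H' H"
    using BH WH by (simp add: is_subgraph_def H'_def)
  have GG': "is_graph G'"
    using G \<open>finite W\<close> by (auto simp: is_graph_def G'_def induced_on_def)
  have "is_bipartite H'"
    unfolding is_bipartite_def
  proof (intro exI conjI ballI)
    \<comment> \<open>The sides are cut out by \<open>nbhd G u\<close>: an edge of \<open>B\<close>
      avoids \<open>nbhd G v\<close>, so it must meet \<open>nbhd G u\<close>, and it does not lie
      inside it.\<close>
    show "(W \<inter> nbhd G u) \<union> (W - nbhd G u) = gverts H'" by (auto simp: H'_def)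
    show "(W \<inter> nbhd G u) \<inter> (W - nbhd G u) = {}" by auto
    fix e assume "e \<in> gedges H'"
    then have e: "e \<in> B" by (simp add: H'_def)
    then have eH: "e \<in> gedges H" using BH by blast
    then obtain p q where pq: "e = {p, q}" using graph_edgeE[OF H] by metis
    have "e \<subseteq> W" using e by (auto simp: W_def)
    moreover have "\<not> e \<subseteq> nbhd G u" using e eH by (auto simp: B_def edges_inside_def)
    moreover have "e \<inter> nbhd G u \<noteq> {}"
      using clique_edge_meets_nbhds[OF HG clique uv eH] \<open>e \<subseteq> W\<close> avoid by blast
    ultimately have "(p \<in> W \<inter> nbhd G u \<and> q \<in> W - nbhd G u) \<or> (q \<in> W \<inter> nbhd G u \<and> p \<in> W - nbhd G u)"
      using pq by auto
    then show "\<exists>x\<in>W \<inter> nbhd G u. \<exists>y\<in>W - nbhd G u. e = {x, y}"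
      using pq by (auto simp: insert_commute)
  qed
  \<comment> \<open>The edge \<open>{u, v}\<close> itself is missing from \<open>B\<close>, because
    \<open>u\<close> is in \<open>nbhd G v\<close>.\<close>
  moreover have "card (gedges H') < card (gedges H)"
  proof -
    have "u \<in> nbhd G v" using uv sub by (auto simp: nbhd_def insert_commute)
    then have "{u, v} \<notin> B" by (auto simp: B_def edges_meeting_def uv)
    then have "B \<subset> gedges H" using BH uv by blast
    then show ?thesis using finite_gedges[OF H] by (simp add: H'_def psubset_card_mono)
  qed
  ultimately have "real (card B) \<le> a * (real (ore_degree G' H'))\<^sup>2"
    using bip[OF H'H] by (simp add: H'_def G'_def)
  moreover have "ore_degree G' H' \<le> ore_degree G H - gdegree H v"
  proof (rule ore_degree_le[OF H'])
    fix p q assume "{p, q} \<in> gedges H'"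
    then have pqB: "{p, q} \<in> B" by (simp add: H'_def)
    then have pq: "{p, q} \<in> gedges H" "p \<in> W" "q \<in> W" using BH by (auto simp: W_def)
    \<comment> \<open>These neighbours of \<open>z\<close> lie in \<open>nbhd G v\<close>, hence
      outside \<open>W\<close>, so \<open>z\<close> loses all of them when passing from
      \<open>G\<close> to \<open>G'\<close>.\<close>
    define C where "C z = nbhd G z \<inter> nbhd H v" for z
    have HvGv: "nbhd H v \<subseteq> nbhd G v" using sub by (auto simp: nbhd_def)
    have fin: "finite (C z)" for z using finite_nbhd[OF H] by (simp add: C_def)
    have deg: "gdegree G' z + card (C z) \<le> gdegree G z" for z
    proof -
      have "nbhd G' z \<inter> C z = {}"
        using HvGv avoid by (auto simp: C_def G'_def induced_on_def nbhd_def)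
      moreover have "nbhd G' z \<union> C z \<subseteq> nbhd G z"
        by (auto simp: C_def G'_def induced_on_def nbhd_def)
      ultimately show ?thesis
        using card_mono[OF finite_nbhd[OF G], of "nbhd G' z \<union> C z" z]
          card_Un_disjoint[OF finite_nbhd[OF GG'] fin, of z z]
        by (simp add: card_nbhd G GG')
    qed
    \<comment> \<open>The clique property is now applied to the edges \<open>{v, w}\<close> and
      \<open>{p, q}\<close>: as \<open>{p, q}\<close> avoids \<open>nbhd G v\<close>, it must meet
      \<open>nbhd G w\<close>.\<close>
    have "nbhd H v \<subseteq> C p \<union> C q"
    proof
      fix w assume w: "w \<in> nbhd H v"
      then have "{v, w} \<in> gedges H" by (simp add: nbhd_def)
      from clique_edge_meets_nbhds[OF HG clique this pq(1)]
      have "{p, q} \<inter> nbhd G w \<noteq> {}" using pq avoid by blast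
      then show "w \<in> C p \<union> C q" using w nbhd_sym[of w G] by (auto simp: C_def)
    qed
    then have "gdegree H v \<le> card (C p \<union> C q)"
      using card_mono[of "C p \<union> C q"] fin card_nbhd[OF H] by (metis finite_Un)
    then have "gdegree H v \<le> card (C p) + card (C q)"
      using card_Un_le le_trans by blast
    then show "gdegree G' p + gdegree G' q \<le> ore_degree G H - gdegree H v"
      using deg[of p] deg[of q] ore_degree_ge[OF H pq(1), of G] by linarith
  qed
  \<comment> \<open>This makes the truncated subtraction above agree with the real one.\<close>
  moreover have "gdegree H v \<le> ore_degree G H"
    using ore_degree_ge[OF H uv, of G] gdegree_mono[OF G HG, of v] by linarith
  ultimately show ?thesis
    using \<open>0 \<le> a\<close> by (smt (verit) mult_left_mono of_nat_0_le_iff of_nat_diff of_nat_mono power_mono)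
qed

text \<open>The count of edges inside \<open>nbhd G u\<close> is traded for the degree sum of
  \<open>u\<close> minus the edges meeting \<open>nbhd G u\<close>. In this form the
  \<open>edges_meeting\<close> terms cancel when the inequalities for \<open>(u, v)\<close> and
  \<open>(v, u)\<close> are added.\<close>

lemma clique_card_le_one_sided:
  fixes G H :: "'v ugraph" and a :: real
  assumes "is_graph G" "is_subgraph H G"
    and "is_clique (line_graph_square G) (gedges H)" "0 \<le> a"
    and "\<And>H' :: 'v ugraph. is_subgraph H' H \<Longrightarrow> is_bipartite H' \<Longrightarrow>
           card (gedges H') < card (gedges H) \<Longrightarrow>
           real (card (gedges H'))
             \<le> a * (real (ore_degree (induced_on G (gverts H')) H'))\<^sup>2"
    and "{u, v} \<in> gedges H"
  shows "real (card (gedges H)) + real (card (edges_meeting H (nbhd G u)))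
    \<le> real (card (edges_meeting H (nbhd G v))) + real (nbhd_degree_sum G H u)
       + a * (real (ore_degree G H) - real (gdegree H v))\<^sup>2"
proof -
  have H: "is_graph H" using assms by (simp add: is_subgraph_def)
  define B where "B = gedges H - edges_meeting H (nbhd G v) - edges_inside H (nbhd G u)"
  have "gedges H \<subseteq> (edges_meeting H (nbhd G v) \<union> edges_inside H (nbhd G u)) \<union> B"
    by (auto simp: B_def)
  then have "card (gedges H) \<le> card ((edges_meeting H (nbhd G v) \<union> edges_inside H (nbhd G u)) \<union> B)"
    using finite_gedges[OF H]
    by (intro card_mono) (auto simp: edges_meeting_def edges_inside_def B_def)
  also have "\<dots> \<le> card (edges_meeting H (nbhd G v)) + card (edges_inside H (nbhd G u)) + card B"
    by (meson add_le_mono card_Un_le le_refl le_trans)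
  finally show ?thesis
    using card_avoiding_edges_le[OF assms B_def]
      sum_gdegree[OF H finite_nbhd[OF assms(1)], of u]
    by (simp add: nbhd_degree_sum_def)
qed

section \<open>The optimization over real parameters\<close>

lemma convex_quadratic_nonpos:
  fixes c z l r p q :: real
  assumes "0 \<le> c" "l \<le> z" "z \<le> r"
    and "c * l\<^sup>2 + p * l + q \<le> 0" "c * r\<^sup>2 + p * r + q \<le> 0"
  shows "c * z\<^sup>2 + p * z + q \<le> 0"
proof (cases "l = r")
  case False
  then have "l < r" using assms by linarith
  \<comment> \<open>Value at \<open>z\<close> as the chord between the endpoint values minus a
    nonnegative convexity term.\<close>
  have "(r - l) * (c * z\<^sup>2 + p * z + q)
      = (r - z) * (c * l\<^sup>2 + p * l + q) + (z - l) * (c * r\<^sup>2 + p * r + q)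
        - c * ((r - l) * ((z - l) * (r - z)))"
    by (simp add: algebra_simps power2_eq_square)
  moreover have "(r - z) * (c * l\<^sup>2 + p * l + q) \<le> 0" "(z - l) * (c * r\<^sup>2 + p * r + q) \<le> 0"
    using assms by (auto intro: mult_nonneg_nonpos)
  moreover have "0 \<le> c * ((r - l) * ((z - l) * (r - z)))"
    using assms by auto
  ultimately have "(r - l) * (c * z\<^sup>2 + p * z + q) \<le> 0" by linarith
  then show ?thesis using \<open>l < r\<close> by (simp add: mult_le_0_iff)
qed (use assms in auto)

lemma degree_optimization:
  fixes a s D D' m :: real
  assumes a: "0 \<le> a" "a \<le> 1 / 3"
    and D: "0 \<le> D'" "D' \<le> D" "D + D' \<le> s"
    and m1: "m \<le> D * (s - D + D')"
    and m2: "2 * m \<le> D * (s - D + D') + a * ((s - D)\<^sup>2 + (s - D')\<^sup>2)"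
  shows "m \<le> (1 + a) / 4 * s\<^sup>2"
proof (rule ccontr)
  assume "\<not> ?thesis"
  then have big: "(1 + a) / 4 * s\<^sup>2 < m" by simp
  have amgm: "4 * (D * (s - D)) \<le> s\<^sup>2"
    using zero_le_power2[of "s - 2 * D"] by (simp add: power2_eq_square algebra_simps)
  have "(1 + a) * (D * (s - D)) \<le> (1 + a) / 4 * s\<^sup>2"
    using mult_left_mono[OF amgm, of "(1 + a) / 4"] a by simp
  then have "D * (a * (s - D)) < D * D'"
    using big m1 by (simp add: algebra_simps)
  \<comment> \<open>If \<open>D'\<close> were smaller, \<open>m1\<close> alone would already give
    the claimed bound.\<close>
  then have low: "a * (s - D) \<le> D'"
    using D mult_less_cancel_left_pos[of D] by (smt (verit) mult_eq_0_iff)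
  \<comment> \<open>The largest value allowed for \<open>D'\<close>. The quadratic below is the
    right side of \<open>m2\<close> with \<open>z\<close> in place of \<open>D'\<close>, minus twice
    the target; being convex in \<open>z\<close>, it need only be checked at both ends.\<close>
  define r where "r = min D (s - D)"
  define p q where "p = D - 2 * a * s"
    and "q = D * (s - D) + a * (s - D)\<^sup>2 + a * s\<^sup>2 - (1 + a) / 2 * s\<^sup>2"
  have f: "a * z\<^sup>2 + p * z + q
      = D * (s - D + z) + a * ((s - D)\<^sup>2 + (s - z)\<^sup>2) - (1 + a) / 2 * s\<^sup>2" for z
    by (simp add: p_def q_def power2_eq_square algebra_simps)
  have "a * D'\<^sup>2 + p * D' + q \<le> 0"
  proof (rule convex_quadratic_nonpos[where l = "a * (s - D)" and r = r])
    let ?E = "s - D"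
    \<comment> \<open>As a quadratic in \<open>s - D\<close> this has discriminant \<open>(1 - a)\<^sup>2 (2 a\<^sup>2 + 2 a - 1) s\<^sup>2 \<le> 0\<close>.\<close>
    have "a * (a * ?E)\<^sup>2 + p * (a * ?E) + q
        = - (1 - a) * ((1 + a + a\<^sup>2) * ?E\<^sup>2 - (1 + 2 * a) * s * ?E + s\<^sup>2 / 2)"
      by (simp add: p_def q_def power2_eq_square field_simps)
    moreover have "0 \<le> (1 + a + a\<^sup>2) * ?E\<^sup>2 - (1 + 2 * a) * s * ?E + s\<^sup>2 / 2"
    proof -
      have "2 * ((1 + a + a\<^sup>2) * ?E\<^sup>2 - (1 + 2 * a) * s * ?E + s\<^sup>2 / 2)
          = (s - (1 + 2 * a) * ?E)\<^sup>2 + (1 - 2 * a - 2 * a\<^sup>2) * ?E\<^sup>2"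
        by (simp add: power2_eq_square algebra_simps)
      moreover have "a\<^sup>2 \<le> 1 / 9" using power_mono[OF a(2,1), of 2] by (simp add: power2_eq_square)
      then have "0 \<le> (1 - 2 * a - 2 * a\<^sup>2) * ?E\<^sup>2" using a by simp
      ultimately show ?thesis by (smt (verit) zero_le_power2)
    qed
    ultimately show "a * (a * ?E)\<^sup>2 + p * (a * ?E) + q \<le> 0"
      using a by (simp add: mult_nonpos_nonneg)
    show "a * r\<^sup>2 + p * r + q \<le> 0"
    proof (cases "2 * D \<le> s")
      case True
      then have "r = D" by (simp add: r_def)
      \<comment> \<open>The hypothesis \<open>a \<le> 1 / 3\<close> makes the factor
        \<open>1 - 3 * a\<close> nonnegative.\<close>
      have "a * D\<^sup>2 + p * D + q = - ((s - 2 * D) * ((1 - 3 * a) * s + 2 * a * D)) / 2"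
        by (simp add: p_def q_def power2_eq_square field_simps)
      moreover have "0 \<le> (s - 2 * D) * ((1 - 3 * a) * s + 2 * a * D)" using a D True by simp
      ultimately show ?thesis unfolding \<open>r = D\<close> by linarith
    next
      case False
      then have "r = ?E" by (simp add: r_def)
      have "a * ?E\<^sup>2 + p * ?E + q = - ((1 - a) * (s - 2 * D)\<^sup>2) / 2"
        by (simp add: p_def q_def power2_eq_square field_simps)
      moreover have "0 \<le> (1 - a) * (s - 2 * D)\<^sup>2" using a by simp
      ultimately show ?thesis unfolding \<open>r = ?E\<close> by linarith
    qed
  qed (use a low D in \<open>auto simp: r_def\<close>)
  then show False using f[of D'] m2 big by (simp add: field_simps)
qed

section \<open>Choice of the edge and conclusion\<close>

theorem theorem5:
  fixes G H :: "'v ugraph" and a :: real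
  assumes "is_graph G"
    and "is_subgraph H G"
    and "is_clique (line_graph_square G) (gedges H)"
    and "1 / 4 \<le> a" and "a \<le> 1 / 3"
    and "\<And>H' :: 'v ugraph. is_subgraph H' H \<Longrightarrow> is_bipartite H' \<Longrightarrow>
           card (gedges H') < card (gedges H) \<Longrightarrow>
           real (card (gedges H'))
             \<le> a * (real (ore_degree (induced_on G (gverts H')) H'))\<^sup>2"
  shows "real (card (gedges H)) \<le> (1 + a) / 4 * (real (ore_degree G H))\<^sup>2"
proof (cases "gedges H = {}")
  case True
  then show ?thesis using assms(4) by simp
next
  case False
  note GH = assms(1-3)
  have G: "is_graph G" and H: "is_graph H" and sub: "gedges H \<subseteq> gedges G" and a0: "0 \<le> a"
    using assms by (simp_all add: is_subgraph_def)
  have finV: "finite (gverts H)" using H by (simp add: is_graph_def)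
  have degG: "gdegree H w \<le> gdegree G w" for w by (rule gdegree_mono[OF assms(1,2)])
  obtain x0 y0 where xy0: "{x0, y0} \<in> gedges H" "x0 \<in> gverts H"
    using False H graph_edgeE by (metis ex_in_conv)
  define D where "D = Max (gdegree H ` gverts H)"
  have "D \<in> gdegree H ` gverts H"
    unfolding D_def using finV xy0(2) by (intro Max_in) auto
  then obtain x where x: "x \<in> gverts H" "gdegree H x = D" by auto
  have D_ge: "gdegree H w \<le> D" for w
  proof (cases "w \<in> gverts H")
    case True
    then show ?thesis unfolding D_def using finV by (intro Max_ge) auto
  next
    case False
    then have "{e \<in> gedges H. w \<in> e} = {}" using H by (auto simp: is_graph_def)
    then show ?thesis unfolding gdegree_def by (metis card.empty le0)
  qed
  have "0 < gdegree H x0"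
    unfolding gdegree_def using xy0 finite_gedges[OF H] by (auto simp: card_gt_0_iff)
  then have "nbhd H x \<noteq> {}"
    using D_ge[of x0] x card_nbhd[OF H, of x] by auto
  define D' where "D' = Max (gdegree H ` nbhd H x)"
  have "D' \<in> gdegree H ` nbhd H x"
    unfolding D'_def using finite_nbhd[OF H] \<open>nbhd H x \<noteq> {}\<close> by (intro Max_in) auto
  then obtain y where y: "y \<in> nbhd H x" "gdegree H y = D'" by auto
  have D'_ge: "gdegree H w \<le> D'" if "w \<in> nbhd H x" for w
    unfolding D'_def using finite_nbhd[OF H] that by (intro Max_ge) auto
  have xy: "{x, y} \<in> gedges H" and yx: "{y, x} \<in> gedges H"
    using y by (simp_all add: nbhd_def insert_commute)
  define s where "s = ore_degree G H"
  have gs: "gdegree G x + gdegree G y \<le> s"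
    unfolding s_def by (rule ore_degree_ge[OF H xy])
  \<comment> \<open>The \<open>D\<close> neighbours of \<open>x\<close> in \<open>H\<close> have
    degree at most \<open>D'\<close>; its other neighbours in \<open>G\<close> only satisfy the
    general bound \<open>D\<close>.\<close>
  have "nbhd_degree_sum G H x \<le> D' * D + D * (gdegree G x - D)"
  proof -
    have Nsub: "nbhd H x \<subseteq> nbhd G x" using sub by (auto simp: nbhd_def)
    have "nbhd_degree_sum G H x
        = (\<Sum>w\<in>nbhd G x - nbhd H x. gdegree H w) + (\<Sum>w\<in>nbhd H x. gdegree H w)"
      unfolding nbhd_degree_sum_def by (rule sum.subset_diff[OF Nsub finite_nbhd[OF G]])
    also have "\<dots> \<le> card (nbhd G x - nbhd H x) * D + card (nbhd H x) * D'"
      using sum_bounded_above[of "nbhd G x - nbhd H x" "gdegree H" D] D_ge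
        sum_bounded_above[of "nbhd H x" "gdegree H" D'] D'_ge by (simp add: add_mono)
    also have "\<dots> = D' * D + D * (gdegree G x - D)"
      using x by (simp add: card_Diff_subset[OF finite_nbhd[OF H] Nsub] card_nbhd G H)
    finally show ?thesis .
  qed
  moreover have "nbhd_degree_sum G H y \<le> D * gdegree G y"
    using sum_bounded_above[of "nbhd G y" "gdegree H" D] D_ge
    by (simp add: nbhd_degree_sum_def card_nbhd[OF G] mult.commute)
  ultimately have "real (nbhd_degree_sum G H x + nbhd_degree_sum G H y)
      \<le> real (D' * D + D * (gdegree G x - D) + D * gdegree G y)"
    by linarith
  also have "\<dots> = real D * (real (gdegree G x + gdegree G y) - real D + real D')"
    using degG[of x] x by (simp add: right_diff_distrib distrib_left of_nat_diff)
  also have "\<dots> \<le> real D * (real s - real D + real D')"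
    using gs by (intro mult_left_mono) auto
  finally have S: "real (nbhd_degree_sum G H x) + real (nbhd_degree_sum G H y)
      \<le> real D * (real s - real D + real D')"
    by simp
  show ?thesis
    unfolding s_def[symmetric]
  proof (rule degree_optimization[OF a0 assms(5), of "real D'" "real D"])
    show "real D' \<le> real D" using D_ge[of y] y by simp
    show "real D + real D' \<le> real s" using degG[of x] degG[of y] x y gs by simp
    show "real (card (gedges H)) \<le> real D * (real s - real D + real D')"
      using clique_card_le_degree_sums[OF GH xy] S by simp
    show "2 * real (card (gedges H)) \<le> real D * (real s - real D + real D')
        + a * ((real s - real D)\<^sup>2 + (real s - real D')\<^sup>2)"
      using clique_card_le_one_sided[OF GH a0 assms(6) xy]
        clique_card_le_one_sided[OF GH a0 assms(6) yx] S x y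
      by (simp add: s_def algebra_simps)
  qed simp
qed

end
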